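(* There exists an LCL problem $\Pi$ on the family of all graphs of maximum degree bounded by a constant that is $\Theta(\sqrt{n})$-mendable: $\Pi$ is $T$-mendable for some function $T$ with $T(n)=O(\sqrt{n})$, and $\Pi$ is not $T'$-mendable for any function $T'$ with $T'(n)=o(\sqrt{n})$.
   Context: A locally verifiable problem $\Pi$ on a graph family $\mathcal{G}$ is given by a set $\Sigma$ of input labels, a set $\Gamma$ of output labels and a verifier $\psi$ with verification radius $r\in\mathbb{N}$: for a graph $G=(V,E)\in\mathcal{G}$ with input labeling, an output labeling $\lambda:V\to\Gamma$ and a node $v$, $\psi(G,\lambda,v)\in\{\text{happy},\text{unhappy}\}$ depends only on the radius-$r$ neighborhood of $v$ (structure, inputs and outputs, up to isomorphism). $\lambda$ is a solution if $\psi$ is happy at every node. $\Pi$ is an LCL problem if $\Sigma,\Gamma$ are finite and all graphs in $\mathcal{G}$ have maximum degree bounded by a constant. Partial labelings are maps $\lambda:V\to\Gamma\cup\{\bot\}$; the relaxed verifier $\psi^*$ is happy at $v$ if some node within distance $r$ of $v$ has label $\bot$, and otherwise $\psi^*(G,\lambda,v)=\psi(G,\lambda',v)$ for any $\lambda':V\to\Gamma$ agreeing with $\lambda$ on the radius-$r$ neighborhood of $v$; $\psi^*$ accepts $\lambda$ if it is happy at all nodes. Given $\lambda$ accepted by $\psi^*$ and a node $v$, a $t$-mend of $\lambda$ at $v$ is a partial labeling $\mu$ such that $\psi^*$ accepts $\mu$, $\mu(v)\neq\bot$, $\mu(u)=\bot$ implies $\lambda(u)=\bot$, and $\mu(u)\neq\lambda(u)$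 implies $u$ is within distance $t$ of $v$. A verifier $\psi$ is $T$-mendable if for every $G\in\mathcal{G}$ with $n$ nodes, every partial labeling $\lambda$ accepted by $\psi^*$ and every node $v$, a $T(n)$-mend of $\lambda$ at $v$ exists. $\Pi$ is $T$-mendable if for some $r$ there is a radius-$r$ verifier for $\Pi$ (accepting exactly the solutions of $\Pi$) that is $T$-mendable. *)

theory Defs
  imports Complex_Main "HOL-Library.Landau_Symbols"
begin

type_synonym graph = "nat set \<times> (nat \<Rightarrow> nat \<Rightarrow> bool)"

definition gV :: "graph \<Rightarrow> nat set" where "gV G = fst G"
definition gE :: "graph \<Rightarrow> nat \<Rightarrow> nat \<Rightarrow> bool" where "gE G = snd G"

definition wf_graph :: "graph \<Rightarrow> bool" where
  "wf_graph G \<longleftrightarrow> finite (gV G) \<and>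
     (\<forall>u v. gE G u v \<longrightarrow> u \<in> gV G \<and> v \<in> gV G \<and> u \<noteq> v \<and> gE G v u)"

definition bdeg_graph :: "nat \<Rightarrow> graph \<Rightarrow> bool" where
  "bdeg_graph \<Delta> G \<longleftrightarrow> wf_graph G \<and> (\<forall>v\<in>gV G. card {u. gE G v u} \<le> \<Delta>)"

fun dist_le :: "graph \<Rightarrow> nat \<Rightarrow> nat \<Rightarrow> nat \<Rightarrow> bool" where
  "dist_le G 0 u w = (u = w \<and> u \<in> gV G)"
| "dist_le G (Suc k) u w = (dist_le G k u w \<or> (\<exists>x. dist_le G k u x \<and> gE G x w))"

definition ball_nodes :: "graph \<Rightarrow> nat \<Rightarrow> nat \<Rightarrow> nat set" where
  "ball_nodes G k v = {u \<in> gV G. dist_le G k v u}"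

definition nbhd_iso :: "nat \<Rightarrow> graph \<Rightarrow> (nat \<Rightarrow> nat) \<Rightarrow> (nat \<Rightarrow> 'a) \<Rightarrow> nat
                        \<Rightarrow> graph \<Rightarrow> (nat \<Rightarrow> nat) \<Rightarrow> (nat \<Rightarrow> 'a) \<Rightarrow> nat \<Rightarrow> bool" where
  "nbhd_iso r G1 inp1 lam1 v1 G2 inp2 lam2 v2 \<longleftrightarrow>
     (\<exists>f. bij_betw f (ball_nodes G1 r v1) (ball_nodes G2 r v2) \<and> f v1 = v2 \<and>
        (\<forall>a\<in>ball_nodes G1 r v1. \<forall>b\<in>ball_nodes G1 r v1. gE G1 a b \<longleftrightarrow> gE G2 (f a) (f b)) \<and>
        (\<forall>a\<in>ball_nodes G1 r v1. inp1 a = inp2 (f a) \<and> lam1 a = lam2 (f a)))"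

definition inputs_ok :: "nat set \<Rightarrow> graph \<Rightarrow> (nat \<Rightarrow> nat) \<Rightarrow> bool" where
  "inputs_ok \<Sigma> G inp \<longleftrightarrow> (\<forall>u\<in>gV G. inp u \<in> \<Sigma>)"

definition outputs_ok :: "nat set \<Rightarrow> graph \<Rightarrow> (nat \<Rightarrow> nat) \<Rightarrow> bool" where
  "outputs_ok \<Gamma> G lam \<longleftrightarrow> (\<forall>u\<in>gV G. lam u \<in> \<Gamma>)"

definition partial_ok :: "nat set \<Rightarrow> graph \<Rightarrow> (nat \<Rightarrow> nat option) \<Rightarrow> bool" where
  "partial_ok \<Gamma> G lam \<longleftrightarrow> (\<forall>u\<in>gV G. lam u = None \<or> the (lam u) \<in> \<Gamma>)"

definition radius_verifier ::
  "nat \<Rightarrow> nat set \<Rightarrow> nat set \<Rightarrow> nat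
     \<Rightarrow> (graph \<Rightarrow> (nat \<Rightarrow> nat) \<Rightarrow> (nat \<Rightarrow> nat) \<Rightarrow> nat \<Rightarrow> bool) \<Rightarrow> bool" where
  "radius_verifier \<Delta> \<Sigma> \<Gamma> r \<psi> \<longleftrightarrow>
     (\<forall>G1 inp1 lam1 v1 G2 inp2 lam2 v2.
        bdeg_graph \<Delta> G1 \<and> inputs_ok \<Sigma> G1 inp1 \<and> outputs_ok \<Gamma> G1 lam1 \<and> v1 \<in> gV G1 \<and>
        bdeg_graph \<Delta> G2 \<and> inputs_ok \<Sigma> G2 inp2 \<and> outputs_ok \<Gamma> G2 lam2 \<and> v2 \<in> gV G2 \<and>
        nbhd_iso r G1 inp1 lam1 v1 G2 inp2 lam2 v2
        \<longrightarrow> \<psi> G1 inp1 lam1 v1 = \<psi> G2 inp2 lam2 v2)"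

definition is_solution ::
  "(graph \<Rightarrow> (nat \<Rightarrow> nat) \<Rightarrow> (nat \<Rightarrow> nat) \<Rightarrow> nat \<Rightarrow> bool)
     \<Rightarrow> graph \<Rightarrow> (nat \<Rightarrow> nat) \<Rightarrow> (nat \<Rightarrow> nat) \<Rightarrow> bool" where
  "is_solution \<psi> G inp lam \<longleftrightarrow> (\<forall>v\<in>gV G. \<psi> G inp lam v)"

definition is_LCL ::
  "nat \<Rightarrow> nat set \<Rightarrow> nat set \<Rightarrow> nat
     \<Rightarrow> (graph \<Rightarrow> (nat \<Rightarrow> nat) \<Rightarrow> (nat \<Rightarrow> nat) \<Rightarrow> nat \<Rightarrow> bool) \<Rightarrow> bool" where
  "is_LCL \<Delta> \<Sigma> \<Gamma> r \<psi> \<longleftrightarrow> finite \<Sigma> \<and> finite \<Gamma> \<and> radius_verifier \<Delta> \<Sigma> \<Gamma> r \<psi>"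

definition relaxed ::
  "nat set \<Rightarrow> nat \<Rightarrow> (graph \<Rightarrow> (nat \<Rightarrow> nat) \<Rightarrow> (nat \<Rightarrow> nat) \<Rightarrow> nat \<Rightarrow> bool)
     \<Rightarrow> graph \<Rightarrow> (nat \<Rightarrow> nat) \<Rightarrow> (nat \<Rightarrow> nat option) \<Rightarrow> nat \<Rightarrow> bool" where
  "relaxed \<Gamma> r \<psi> G inp lam v \<longleftrightarrow>
     (\<exists>u\<in>ball_nodes G r v. lam u = None) \<or>
     (\<forall>lam'. outputs_ok \<Gamma> G lam' \<and> (\<forall>u\<in>ball_nodes G r v. lam u = Some (lam' u))
             \<longrightarrow> \<psi> G inp lam' v)"

definition relaxed_accepts ::
  "nat set \<Rightarrow> nat \<Rightarrow> (graph \<Rightarrow> (nat \<Rightarrow> nat) \<Rightarrow> (nat \<Rightarrow> nat) \<Rightarrow> nat \<Rightarrow> bool)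
     \<Rightarrow> graph \<Rightarrow> (nat \<Rightarrow> nat) \<Rightarrow> (nat \<Rightarrow> nat option) \<Rightarrow> bool" where
  "relaxed_accepts \<Gamma> r \<psi> G inp lam \<longleftrightarrow> (\<forall>v\<in>gV G. relaxed \<Gamma> r \<psi> G inp lam v)"

definition within_real :: "graph \<Rightarrow> real \<Rightarrow> nat \<Rightarrow> nat \<Rightarrow> bool" where
  "within_real G t v u \<longleftrightarrow> (\<exists>k. real k \<le> t \<and> dist_le G k v u)"

definition is_mend ::
  "nat set \<Rightarrow> nat \<Rightarrow> (graph \<Rightarrow> (nat \<Rightarrow> nat) \<Rightarrow> (nat \<Rightarrow> nat) \<Rightarrow> nat \<Rightarrow> bool)
     \<Rightarrow> graph \<Rightarrow> (nat \<Rightarrow> nat) \<Rightarrow> (nat \<Rightarrow> nat option) \<Rightarrow> nat \<Rightarrow> real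
     \<Rightarrow> (nat \<Rightarrow> nat option) \<Rightarrow> bool" where
  "is_mend \<Gamma> r \<psi> G inp lam v t mu \<longleftrightarrow>
     partial_ok \<Gamma> G mu \<and> relaxed_accepts \<Gamma> r \<psi> G inp mu \<and> mu v \<noteq> None \<and>
     (\<forall>u\<in>gV G. mu u = None \<longrightarrow> lam u = None) \<and>
     (\<forall>u\<in>gV G. mu u \<noteq> lam u \<longrightarrow> within_real G t v u)"

definition verifier_mendable ::
  "nat \<Rightarrow> nat set \<Rightarrow> nat set \<Rightarrow> nat
     \<Rightarrow> (graph \<Rightarrow> (nat \<Rightarrow> nat) \<Rightarrow> (nat \<Rightarrow> nat) \<Rightarrow> nat \<Rightarrow> bool) \<Rightarrow> (nat \<Rightarrow> real) \<Rightarrow> bool" where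
  "verifier_mendable \<Delta> \<Sigma> \<Gamma> r \<psi> T \<longleftrightarrow>
     (\<forall>G inp lam v. bdeg_graph \<Delta> G \<and> inputs_ok \<Sigma> G inp \<and> partial_ok \<Gamma> G lam \<and>
        relaxed_accepts \<Gamma> r \<psi> G inp lam \<and> v \<in> gV G
        \<longrightarrow> (\<exists>mu. is_mend \<Gamma> r \<psi> G inp lam v (T (card (gV G))) mu))"

definition problem_mendable ::
  "nat \<Rightarrow> nat set \<Rightarrow> nat set
     \<Rightarrow> (graph \<Rightarrow> (nat \<Rightarrow> nat) \<Rightarrow> (nat \<Rightarrow> nat) \<Rightarrow> nat \<Rightarrow> bool) \<Rightarrow> (nat \<Rightarrow> real) \<Rightarrow> bool" where
  "problem_mendable \<Delta> \<Sigma> \<Gamma> \<psi> T \<longleftrightarrow>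
     (\<exists>r' \<psi>'. radius_verifier \<Delta> \<Sigma> \<Gamma> r' \<psi>' \<and>
        (\<forall>G inp lam. bdeg_graph \<Delta> G \<and> inputs_ok \<Sigma> G inp \<and> outputs_ok \<Gamma> G lam \<longrightarrow>
           (is_solution \<psi>' G inp lam \<longleftrightarrow> is_solution \<psi> G inp lam)) \<and>
        verifier_mendable \<Delta> \<Sigma> \<Gamma> r' \<psi>' T)"

end

theory Submission
  imports Defs "HOL-Library.Nat_Bijection"
begin

text \<open>Inputs are residues modulo 5; in a grid the node \<open>(x, y)\<close> carries \<open>x + 2 y\<close>, so that the steps
  right, up and down change the residue by 1, 2 and 3. An output is 0 or one of these three
  directions. A node with an output \<open>d \<noteq> 0\<close> points at its \<open>d\<close>-neighbour, which must have a nonzero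
  output as well and must not point back; only nodes whose three neighbours exist and are unique
  are constrained. Hence pointers never turn back and never go left, so in a grid they cannot run
  in a circle: a chain of pointers that breaks off in the middle of a large grid cannot be repaired
  without changing outputs as far away as the border or the start of the chain. Conversely, among
  more than \<open>n\<close> nodes reached by at most \<open>\<surd>n\<close> steps right followed by at most \<open>\<surd>n\<close> steps up, either
  one is unconstrained or unlabelled, or two coincide; in both cases a broken chain can be
  continued and properly ended within distance \<open>O(\<surd>n)\<close>.\<close>

section \<open>The pointer problem\<close>

definition step :: "graph \<Rightarrow> (nat \<Rightarrow> nat) \<Rightarrow> nat \<Rightarrow> nat \<Rightarrow> nat \<Rightarrow> bool" where
  "step G inp d u w \<longleftrightarrow> gE G u w \<and> inp w = (inp u + d) mod 5"

definition good :: "graph \<Rightarrow> (nat \<Rightarrow> nat) \<Rightarrow> nat \<Rightarrow> bool" where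
  "good G inp u \<longleftrightarrow> (\<forall>d\<in>{1,2,3}. \<exists>!w. step G inp d u w)"

text \<open>The clause \<open>lam u + lam w \<noteq> 5\<close> excludes exactly the opposite directions 2 and 3.\<close>

definition pointer_ok :: "graph \<Rightarrow> (nat \<Rightarrow> nat) \<Rightarrow> (nat \<Rightarrow> nat) \<Rightarrow> nat \<Rightarrow> bool" where
  "pointer_ok G inp lam u \<longleftrightarrow> (good G inp u \<and> lam u \<noteq> 0 \<longrightarrow>
     (\<exists>w. step G inp (lam u) u w \<and> lam w \<noteq> 0 \<and> lam u + lam w \<noteq> 5))"

section \<open>Locality of the problem\<close>

lemma dist_le_trans:
  assumes "dist_le G k u v" "dist_le G l v w"
  shows "dist_le G (k + l) u w"
  using assms(2) by (induction l arbitrary: w) (use assms(1) in auto)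

lemma dist_le_mono:
  assumes "dist_le G k u v" "k \<le> l"
  shows "dist_le G l u v"
  using assms(2,1) by (induction l rule: dec_induct) auto

lemma ball_nodes_1:
  assumes "wf_graph G" "v \<in> gV G"
  shows "ball_nodes G 1 v = insert v {u. gE G v u}"
  using assms by (auto simp: ball_nodes_def wf_graph_def)

text \<open>The isomorphism preserves inputs and the edges at the centre, hence maps the
  \<open>d\<close>-neighbours of \<open>v1\<close> bijectively onto those of \<open>v2\<close>, for
  every \<open>d\<close>.\<close>

lemma pointer_ok_iso:
  assumes wf: "wf_graph G1" "wf_graph G2" and v: "v1 \<in> gV G1" "v2 \<in> gV G2"
    and iso: "nbhd_iso 1 G1 inp1 lam1 v1 G2 inp2 lam2 v2"
  shows "pointer_ok G1 inp1 lam1 v1 = pointer_ok G2 inp2 lam2 v2"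
proof -
  let ?B1 = "insert v1 {u. gE G1 v1 u}" and ?B2 = "insert v2 {u. gE G2 v2 u}"
  obtain f where bij: "bij_betw f ?B1 ?B2" and fv: "f v1 = v2"
    and E: "\<And>a b. a \<in> ?B1 \<Longrightarrow> b \<in> ?B1 \<Longrightarrow> gE G1 a b \<longleftrightarrow> gE G2 (f a) (f b)"
    and L: "\<And>a. a \<in> ?B1 \<Longrightarrow> inp1 a = inp2 (f a) \<and> lam1 a = lam2 (f a)"
    using iso unfolding nbhd_iso_def ball_nodes_1[OF wf(1) v(1)] ball_nodes_1[OF wf(2) v(2)]
    by blast
  let ?S1 = "\<lambda>d. {w. step G1 inp1 d v1 w}" and ?S2 = "\<lambda>d. {w. step G2 inp2 d v2 w}"
  have E1: "gE G1 v1 a \<longleftrightarrow> gE G2 v2 (f a)" if "a \<in> ?B1" for a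
    using E[of v1 a] that fv by blast
  have inp1: "inp1 v1 = inp2 v2" and lam1: "lam1 v1 = lam2 v2" using L[of v1] fv by auto
  have step: "step G1 inp1 d v1 a \<longleftrightarrow> step G2 inp2 d v2 (f a)" if "a \<in> ?B1" for d a
    unfolding step_def E1[OF that] inp1 using L[OF that] by presburger
  have img: "f ` ?S1 d = ?S2 d" for d
  proof
    show "f ` ?S1 d \<subseteq> ?S2 d"
    proof clarify
      fix a assume "step G1 inp1 d v1 a"
      then show "step G2 inp2 d v2 (f a)" using step[of a d] by (simp add: step_def)
    qed
    show "?S2 d \<subseteq> f ` ?S1 d"
    proof clarify
      fix w assume w: "step G2 inp2 d v2 w"
      then have "w \<in> f ` ?B1" using bij by (simp add: bij_betw_def step_def)
      then show "w \<in> f ` ?S1 d" using w step by blast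
    qed
  qed
  have inj: "inj_on f (?S1 d)" for d
    using bij by (rule inj_on_subset[OF bij_betw_imp_inj_on]) (auto simp: step_def)
  have ex1: "(\<exists>!w. P w) \<longleftrightarrow> card {w. P w} = 1" for P :: "nat \<Rightarrow> bool"
    by (auto simp: card_1_singleton_iff set_eq_iff)
  have good: "good G1 inp1 v1 = good G2 inp2 v2"
    unfolding good_def ex1 by (simp flip: img add: card_image[OF inj])
  have "(\<exists>w\<in>?S1 d. lam1 w \<noteq> 0 \<and> d + lam1 w \<noteq> 5) \<longleftrightarrow>
        (\<exists>w\<in>?S2 d. lam2 w \<noteq> 0 \<and> d + lam2 w \<noteq> 5)" for d
  proof -
    have "lam1 w = lam2 (f w)" if "w \<in> ?S1 d" for w
      using L[of w] that by (simp add: step_def)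
    then show ?thesis unfolding img[symmetric] by simp
  qed
  then show ?thesis unfolding pointer_ok_def good lam1 by simp
qed

lemma pointer_LCL: "is_LCL \<Delta> {..<5} {..<4} 1 pointer_ok"
  unfolding is_LCL_def radius_verifier_def bdeg_graph_def
  by (intro conjI finite_lessThan allI impI pointer_ok_iso; elim conjE; assumption)

section \<open>Mending within distance proportional to the square root\<close>

text \<open>\<open>THE\<close> has a meaning only at good nodes and for directions 1, 2 and 3; walks
  are therefore cut at the first node that is not good.\<close>

definition next_node :: "graph \<Rightarrow> (nat \<Rightarrow> nat) \<Rightarrow> nat \<Rightarrow> nat \<Rightarrow> nat" where
  "next_node G inp d u = (THE w. step G inp d u w)"

lemma step_next_node:
  assumes "good G inp u" "d \<in> {1,2,3}"
  shows "step G inp d u w \<longleftrightarrow> w = next_node G inp d u"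
proof -
  have "\<exists>!w. step G inp d u w" using assms by (auto simp: good_def)
  then show ?thesis unfolding next_node_def by (metis theI')
qed

lemma good_in_V: "wf_graph G \<Longrightarrow> good G inp u \<Longrightarrow> u \<in> gV G"
  by (auto simp: good_def step_def wf_graph_def)

text \<open>Directions with sum 5 cancel modulo 5, and as inputs are below 5, the input of
  \<open>u\<close> is recovered exactly.\<close>

lemma step_reverse:
  assumes "wf_graph G" "inputs_ok {..<5} G inp" "step G inp d u w" "d + e = 5"
  shows "step G inp e w u"
proof -
  have E: "gE G w u" "u \<in> gV G" "inp w = (inp u + d) mod 5"
    using assms by (auto simp: step_def wf_graph_def)
  have "(inp w + e) mod 5 = (inp u + (d + e)) mod 5"
    unfolding E(3) by (simp add: mod_simps add.assoc)
  also have "\<dots> = inp u"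
    using E(2) assms(2,4) by (auto simp: inputs_ok_def)
  finally show ?thesis using E(1) by (simp add: step_def)
qed

lemma next_node_down_up:
  assumes "wf_graph G" "inputs_ok {..<5} G inp" "good G inp u" "good G inp (next_node G inp 2 u)"
  shows "next_node G inp 3 (next_node G inp 2 u) = u"
proof -
  have "step G inp 2 u (next_node G inp 2 u)" using assms(3) by (simp add: step_next_node)
  then have "step G inp 3 (next_node G inp 2 u) u" using step_reverse[OF assms(1,2)] by simp
  then show ?thesis using assms(4) by (simp add: step_next_node)
qed

section \<open>The relaxed verifier at radius 1\<close>

definition happy :: "graph \<Rightarrow> (nat \<Rightarrow> nat) \<Rightarrow> (nat \<Rightarrow> nat option) \<Rightarrow> nat \<Rightarrow> bool" where
  "happy G inp mu z \<longleftrightarrow> mu z = None \<or> (\<exists>u. gE G z u \<and> mu u = None) \<or>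
     pointer_ok G inp (\<lambda>u. the (mu u)) z"

text \<open>\<open>pointer_ok\<close> reads only labels inside the ball, so all completions of a
  fully labelled ball get the same verdict.\<close>

lemma relaxed_iff_happy:
  assumes wf: "wf_graph G" and z: "z \<in> gV G" and ok: "partial_ok {..<4} G mu"
  shows "relaxed {..<4} 1 pointer_ok G inp mu z \<longleftrightarrow> happy G inp mu z"
proof -
  have B: "ball_nodes G 1 z = insert z {u. gE G z u}" by (rule ball_nodes_1[OF wf z])
  show ?thesis
  proof (cases "\<exists>u\<in>ball_nodes G 1 z. mu u = None")
    case True
    then show ?thesis unfolding relaxed_def happy_def B by auto
  next
    case False
    have cong: "pointer_ok G inp lam z = pointer_ok G inp (\<lambda>u. the (mu u)) z"
      if "\<forall>u\<in>ball_nodes G 1 z. mu u = Some (lam u)" for lam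
    proof -
      have *: "lam z = the (mu z)" "\<And>u. gE G z u \<Longrightarrow> lam u = the (mu u)"
        using that unfolding B by auto
      show ?thesis unfolding pointer_ok_def *(1) by (metis *(2) step_def)
    qed
    \<comment> \<open>One admissible completion has to be exhibited, since otherwise the universal
      quantifier in \<open>relaxed\<close> could hold vacuously.\<close>
    let ?lam = "\<lambda>u. case mu u of None \<Rightarrow> 0 | Some a \<Rightarrow> a"
    have out: "outputs_ok {..<4} G ?lam"
      using ok by (auto simp: outputs_ok_def partial_ok_def split: option.splits)
    have agree: "\<forall>u\<in>ball_nodes G 1 z. mu u = Some (?lam u)" using False by auto
    have "relaxed {..<4} 1 pointer_ok G inp mu z \<longleftrightarrow> pointer_ok G inp (\<lambda>u. the (mu u)) z"
      unfolding relaxed_def using False cong out agree by metis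
    moreover have "happy G inp mu z \<longleftrightarrow> pointer_ok G inp (\<lambda>u. the (mu u)) z"
      unfolding happy_def using False B by blast
    ultimately show ?thesis by blast
  qed
qed

text \<open>Pointing along a walk up to its first repetition or obstruction repairs its starting node and
  damages no other node: a node \<open>y\<close> that would now be pointed at against the direction of its
  new pointer is entered from the next node of the walk, which is overwritten as well.\<close>

lemma repair_along_walk:
  assumes wf: "wf_graph G" and inp: "inputs_ok {..<5} G inp" and ok: "partial_ok {..<4} G mu"
    and w: "w \<in> gV G" "mu w \<noteq> None"
    and x0: "x 0 = w" and xS: "\<And>i. x (Suc i) = next_node G inp (d i) (x i)"
    and d: "\<And>i. d i \<in> {1,2,3}" and norev: "\<And>i. d i + d (Suc i) \<noteq> 5"
    and stop: "\<not> good G inp (x K) \<or> mu (x K) = None \<or> (\<exists>i<K. x i = x K)"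
  shows "\<exists>mu'. partial_ok {..<4} G mu' \<and> (\<forall>u. mu' u = None \<longleftrightarrow> mu u = None) \<and>
     (\<forall>u. mu' u \<noteq> mu u \<longrightarrow> dist_le G K w u) \<and>
     happy G inp mu' w \<and> (\<forall>z. happy G inp mu z \<longrightarrow> happy G inp mu' z)"
proof -
  let ?stop = "\<lambda>k. \<not> good G inp (x k) \<or> mu (x k) = None \<or> (\<exists>i<k. x i = x k)"
  \<comment> \<open>Cutting at the first obstruction makes all nodes before \<open>x k\<close> good,
    labelled and pairwise distinct.\<close>
  define k where "k = (LEAST k. ?stop k)"
  have stk: "?stop k" unfolding k_def by (rule LeastI[of ?stop K]) (rule stop)
  have kK: "k \<le> K" unfolding k_def by (rule Least_le) (rule stop)
  have ns: "\<not> ?stop i" if "i < k" for i using not_less_Least[of i ?stop] that unfolding k_def by blast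
  have gd: "good G inp (x i)" if "i < k" for i using ns[OF that] by simp
  have nn: "mu (x i) \<noteq> None" if "i < k" for i using ns[OF that] by simp
  have dj: "x j \<noteq> x i" if "i < k" "j < i" for i j using ns[OF that(1)] that(2) by blast
  have inj: "i = j" if "i < k" "j < k" "x i = x j" for i j
    using dj[OF that(1), of j] dj[OF that(2), of i] that(3) by (cases i j rule: linorder_cases) auto
  have stp: "step G inp (d i) (x i) (x (Suc i))" if "i < k" for i
    using step_next_node[OF gd[OF that] d] xS by simp
  have dist: "dist_le G i w (x i)" if "i \<le> k" for i
    using that
  proof (induction i)
    case 0 then show ?case using x0 w by simp
  next
    case (Suc i)
    then show ?case using stp[of i] by (auto simp: step_def)
  qed
  \<comment> \<open>The last node \<open>x k\<close> is overwritten only if it is labelled, so that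
    no node gains or loses a label.\<close>
  define P where "P = {u. (\<exists>i\<le>k. u = x i) \<and> mu u \<noteq> None}"
  \<comment> \<open>A last node that repeats no earlier one gets the default 1, which no pointer
    opposes because outputs are below 4. If \<open>x k\<close> repeats an earlier node, that node
    keeps its own direction.\<close>
  define del where "del u = (if \<exists>i<k. x i = u then d (THE i. i < k \<and> x i = u) else 1)" for u
  have delx: "del (x i) = d i" if "i < k" for i
  proof -
    have "(THE j. j < k \<and> x j = x i) = i" using that inj by blast
    then show ?thesis using that unfolding del_def by auto
  qed
  have del123: "del u \<in> {1,2,3}" for u using d unfolding del_def by auto
  have Px: "x i \<in> P" if "i < k" for i using nn[OF that] less_imp_le[OF that] unfolding P_def by blast
  have PE: "(\<exists>i<k. u = x i) \<or> (\<not> good G inp u \<and> del u = 1)" if "u \<in> P" for u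
  proof -
    obtain i where i: "i \<le> k" "u = x i" "mu u \<noteq> None" using \<open>u \<in> P\<close> P_def by auto
    show ?thesis
    proof (cases "\<exists>i<k. u = x i")
      case False
      then have "i = k" using i(1,2) by (cases "i < k") auto
      then have "u = x k" using i(2) by simp
      moreover have "\<not> (\<exists>j<k. x j = u)" using False by blast
      ultimately show ?thesis using stk i(3) unfolding del_def by auto
    qed blast
  qed
  define mu' where "mu' u = (if u \<in> P then Some (del u) else mu u)" for u
  have none: "mu' u = None \<longleftrightarrow> mu u = None" for u
    unfolding mu'_def P_def by auto
  have ok': "partial_ok {..<4} G mu'"
    unfolding partial_ok_def
  proof
    fix u assume "u \<in> gV G"
    then show "mu' u = None \<or> the (mu' u) \<in> {..<4}"
      using ok del123[of u] unfolding partial_ok_def mu'_def by auto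
  qed
  have chg: "dist_le G K w u" if "mu' u \<noteq> mu u" for u
  proof -
    have "u \<in> P" using that unfolding mu'_def by presburger
    then obtain i where "i \<le> k" "u = x i" unfolding P_def by blast
    then show ?thesis using dist_le_mono[OF dist, of i K] kK by simp
  qed
  have hP: "happy G inp mu' u" if "u \<in> P" for u
    using PE[OF that]
  proof
    assume "\<exists>i<k. u = x i"
    then obtain i where i: "i < k" "u = x i" by blast
    show ?thesis
    proof (cases "mu (x (Suc i)) = None")
      case True
      then show ?thesis using stp[OF i(1)] i(2) none unfolding happy_def step_def by auto
    next
      case False
      then have SP: "x (Suc i) \<in> P" using i(1) unfolding P_def by (auto intro: exI[of _ "Suc i"])
      \<comment> \<open>If the next node pointed back, it would be some \<open>x j\<close> whose
        successor \<open>x (Suc j)\<close> is \<open>x i\<close>. Distinctness forces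
        \<open>j = Suc i\<close> or \<open>i = Suc j\<close>, excluded by \<open>norev\<close>, or
        else both are the last step, where \<open>d i + d j\<close> is even.\<close>
      have "d i + del (x (Suc i)) \<noteq> 5"
      proof
        assume eq: "d i + del (x (Suc i)) = 5"
        then have "del (x (Suc i)) \<noteq> 1" using d[of i] by auto
        then obtain j where j: "j < k" "x (Suc i) = x j" using PE[OF SP] by blast
        have "d i + d j = 5" using eq delx[OF j(1)] j(2) by simp
        then have "step G inp (d j) (x j) (x i)"
          using step_reverse[OF wf inp stp[OF i(1)]] j(2) by simp
        then have xj: "x i = x (Suc j)" 
          using step_next_node[OF gd[OF j(1)] d] xS by simp
        have "j = Suc i" if "Suc i < k" using inj[OF that j(1)] j(2) by simp
        moreover have "i = Suc j" if "Suc j < k" using inj[OF i(1) that] xj by simp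
        ultimately have "j = Suc i \<or> i = Suc j \<or> (Suc i = k \<and> Suc j = k)" using i(1) j(1) by linarith
        then show False
        proof (elim disjE)
          assume "j = Suc i" then show False using norev[of i] \<open>d i + d j = 5\<close> by simp
        next
          assume "i = Suc j" then show False using norev[of j] \<open>d i + d j = 5\<close> by (simp add: add.commute)
        next
          assume "Suc i = k \<and> Suc j = k"
          then have "d i + d i = 5" using \<open>d i + d j = 5\<close> by auto
          then show False by presburger
        qed
      qed
      then have "pointer_ok G inp (\<lambda>u. the (mu' u)) u"
        using stp[OF i(1)] SP Px[OF i(1)] delx[OF i(1)] i(2) del123[of "x (Suc i)"]
        unfolding pointer_ok_def mu'_def by auto
      then show ?thesis unfolding happy_def by blast
    qed
  next
    assume "\<not> good G inp u \<and> del u = 1"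
    then show ?thesis unfolding happy_def pointer_ok_def by blast
  qed
  have keep: "happy G inp mu' z" if h: "happy G inp mu z" for z
  proof (cases "z \<in> P \<or> mu z = None \<or> (\<exists>u. gE G z u \<and> mu u = None) \<or> \<not> good G inp z \<or> mu z = Some 0")
    case True
    then show ?thesis
    proof (elim disjE)
      assume "mu z = Some 0"
      then show ?thesis using hP[of z] unfolding happy_def pointer_ok_def mu'_def by auto
    qed (use hP none in \<open>auto simp: happy_def pointer_ok_def\<close>)
  next
    case False
    let ?e = "the (mu z)"
    have mz: "mu' z = mu z" using False unfolding mu'_def by simp
    have e0: "?e \<noteq> 0" using False by auto
    obtain y where y: "step G inp ?e z y" "the (mu y) \<noteq> 0" "?e + the (mu y) \<noteq> 5"
      using h False e0 unfolding happy_def pointer_ok_def by auto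
    have "the (mu' y) \<noteq> 0 \<and> ?e + the (mu' y) \<noteq> 5"
    proof (cases "y \<in> P")
      case yP: True
      have "?e + del y \<noteq> 5"
      proof
        assume eq: "?e + del y = 5"
        have "z \<in> gV G" using good_in_V[OF wf] False by blast
        then have "?e < 4" using ok False unfolding partial_ok_def by auto
        then have "del y \<noteq> 1" using eq by auto
        then obtain j where j: "j < k" "y = x j" using PE[OF yP] by blast
        have "step G inp (d j) y z"
          using step_reverse[OF wf inp y(1) eq] delx[OF j(1)] j(2) by simp
        then have "z = x (Suc j)"
          using step_next_node[OF gd[OF j(1)] d] xS j(2) by simp
        then have "z \<in> P" using False j(1) unfolding P_def by (auto intro: exI[of _ "Suc j"])
        then show False using False by simp
      qed
      then show ?thesis using yP del123[of y] unfolding mu'_def by auto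
    next
      case yP: False
      then show ?thesis using y unfolding mu'_def by simp
    qed
    then show ?thesis using y(1) mz unfolding happy_def pointer_ok_def by auto
  qed
  have "happy G inp mu' w"
  proof -
    have "w \<in> P" using x0 w(2) unfolding P_def by (auto intro!: exI[of _ 0])
    then show ?thesis by (rule hP)
  qed
  then show ?thesis using ok' none chg keep by blast
qed

text \<open>The walks go right and then only up, or right and then only down. If none of the
  \<open>(t + 1)\<^sup>2\<close> nodes reached by at most \<open>t\<close> steps right and then at most \<open>t\<close> steps up is an
  obstruction, two of them coincide; cancelling common up-steps closes up one of the walks.\<close>

lemma repair_node:
  assumes wf: "wf_graph G" and inp: "inputs_ok {..<5} G inp" and ok: "partial_ok {..<4} G mu"
    and w: "w \<in> gV G" "mu w \<noteq> None" and card: "card (gV G) < (Suc t)\<^sup>2"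
  shows "\<exists>mu'. partial_ok {..<4} G mu' \<and> (\<forall>u. mu' u = None \<longleftrightarrow> mu u = None) \<and>
     (\<forall>u. mu' u \<noteq> mu u \<longrightarrow> dist_le G (2 * t) w u) \<and>
     happy G inp mu' w \<and> (\<forall>z. happy G inp mu z \<longrightarrow> happy G inp mu' z)"
proof (rule ccontr)
  assume contr: "\<not> ?thesis"
  let ?nx = "next_node G inp"
  \<comment> \<open>\<open>X i\<close> lies \<open>i\<close> steps right of \<open>w\<close>,
    \<open>g i j\<close> another \<open>j\<close> steps up, and \<open>walk e i\<close> turns into
    direction \<open>e\<close> after \<open>i\<close> steps right.\<close>
  define X where "X i = (?nx 1 ^^ i) w" for i
  define g where "g i j = (?nx 2 ^^ j) (X i)" for i j
  define walk where "walk e i l = (if l \<le> i then X l else (?nx e ^^ (l - i)) (X i))" for e i l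
  have walk_after: "walk e i (i + j) = (?nx e ^^ j) (X i)" for e i j
    unfolding walk_def by auto
  have no_stop: "good G inp (walk e i k) \<and> (\<forall>l<k. walk e i l \<noteq> walk e i k)"
    if e: "e = 2 \<or> e = 3" and k: "k \<le> 2 * t" for e i k
  proof (rule ccontr)
    assume stop: "\<not> (good G inp (walk e i k) \<and> (\<forall>l<k. walk e i l \<noteq> walk e i k))"
    let ?d = "\<lambda>l. if l < i then 1 else e"
    have 1: "walk e i 0 = w" by (simp add: walk_def X_def)
    have 2: "walk e i (Suc l) = ?nx (?d l) (walk e i l)" for l
      by (auto simp: walk_def X_def Suc_diff_le not_le less_Suc_eq_le)
    \<comment> \<open>Consecutive directions have sum 2, 3, 4 or 6.\<close>
    have 3: "?d l \<in> {1,2,3}" "?d l + ?d (Suc l) \<noteq> 5" for l using e by auto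
    obtain mu' where mu': "partial_ok {..<4} G mu'" "\<forall>u. mu' u = None \<longleftrightarrow> mu u = None"
      "\<forall>u. mu' u \<noteq> mu u \<longrightarrow> dist_le G k w u" "happy G inp mu' w"
      "\<forall>z. happy G inp mu z \<longrightarrow> happy G inp mu' z"
      using repair_along_walk[OF wf inp ok w, of "walk e i" ?d k, OF 1 2 3] stop by blast
    then show False using contr dist_le_mono[OF _ k] by blast
  qed
  have gd: "good G inp (g i j)" if "i \<le> t" "j \<le> t" for i j
    using no_stop[of 2 "i + j" i] that walk_after[of 2 i j] unfolding g_def by simp
  have g_Suc: "g i (Suc j) = ?nx 2 (g i j)" for i j by (simp add: g_def)
  have down: "?nx 3 (g i (Suc j)) = g i j" if "i \<le> t" "Suc j \<le> t" for i j
    using next_node_down_up[OF wf inp gd[of i j]] gd[of i "Suc j"] that by (simp add: g_Suc)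
  have cancel: "g i 0 = g k b" if "i \<le> t" "k \<le> t" "j + b \<le> t" "g i j = g k (j + b)" for i j k b
    using that(3,4)
  proof (induction j)
    case (Suc j)
    then have "g i j = g k (j + b)" using down[of i j] down[of k "j + b"] that(1,2) by simp
    then show ?case using Suc by simp
  qed simp
  have descend: "(?nx 3 ^^ b) (g k b) = X k" if "k \<le> t" "b \<le> t" for k b
    using that(2)
  proof (induction b)
    case (Suc b)
    then show ?case using down[of k b] that(1) by (simp add: funpow_swap1)
  qed (simp add: g_def)
  have inj: "i = k \<and> j = l" if le: "i \<le> t" "k \<le> t" "l \<le> t" "j \<le> l" and eq: "g i j = g k l" for i j k l
  proof -
    define b where "b = l - j"
    have "g i 0 = g k b" using cancel[of i k j b] le eq unfolding b_def by simp
    then have Xi: "X i = g k b" by (simp add: g_def)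
    have bt: "b \<le> t" using le unfolding b_def by simp
    show ?thesis
    proof (rule ccontr)
      assume "\<not> ?thesis"
      then have ne: "i \<noteq> k \<or> b \<noteq> 0" using le unfolding b_def by auto
      \<comment> \<open>If \<open>i \<le> k\<close>, the walk turning up at \<open>k\<close> meets
        \<open>X i\<close> twice. Otherwise, since \<open>X i = g k b\<close>, the walk turning down
        at \<open>i\<close> descends to \<open>X k\<close>, which it has already passed.\<close>
      show False
      proof (cases "i \<le> k")
        case True
        have "walk 2 k (k + b) = walk 2 k i"
          using Xi True walk_after[of 2 k b] by (simp add: g_def walk_def)
        moreover have "i < k + b" using ne True by auto
        ultimately show False using no_stop[of 2 "k + b" k] le bt by auto
      next
        case False
        have "walk 3 i (i + b) = X k"
          unfolding walk_after Xi using descend le(2) bt by simp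
        moreover have "walk 3 i k = X k" using False by (simp add: walk_def)
        ultimately show False using no_stop[of 3 "i + b" i] False le bt by auto
      qed
    qed
  qed
  have "inj_on (\<lambda>(i, j). g i j) ({..t} \<times> {..t})"
  proof (rule inj_onI, clarsimp)
    fix i j k l assume "i \<le> t" "j \<le> t" "k \<le> t" "l \<le> t" "g i j = g k l"
    then show "i = k \<and> j = l"
      using inj[of i k l j] inj[of k i j l] by (cases "j \<le> l") auto
  qed
  moreover have "(\<lambda>(i, j). g i j) ` ({..t} \<times> {..t}) \<subseteq> gV G"
    using gd good_in_V[OF wf] by auto
  moreover have "finite (gV G)" using wf by (simp add: wf_graph_def)
  ultimately have "card ({..t} \<times> {..t}) \<le> card (gV G)"
    using card_inj_on_le by blast
  then show False using card by (simp add: card_cartesian_product power2_eq_square)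
qed

text \<open>Labelling a node may reveal several violations at its neighbours, which are repaired one by one.\<close>

lemma repair_all:
  assumes wf: "wf_graph G" and inp: "inputs_ok {..<5} G inp" and ok: "partial_ok {..<4} G mu"
    and card: "card (gV G) < (Suc t)\<^sup>2"
  shows "\<exists>mu'. partial_ok {..<4} G mu' \<and> (\<forall>u. mu' u = None \<longleftrightarrow> mu u = None) \<and>
     (\<forall>u. mu' u \<noteq> mu u \<longrightarrow> (\<exists>w\<in>gV G. \<not> happy G inp mu w \<and> dist_le G (2 * t) w u)) \<and>
     (\<forall>z\<in>gV G. happy G inp mu' z)"
  using ok
proof (induction "card {z \<in> gV G. \<not> happy G inp mu z}" arbitrary: mu rule: less_induct)
  case less
  let ?bad = "\<lambda>mu. {z \<in> gV G. \<not> happy G inp mu z}"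
  show ?case
  proof (cases "?bad mu = {}")
    case True
    then show ?thesis using less.prems by blast
  next
    case False
    then obtain w where w: "w \<in> gV G" "\<not> happy G inp mu w" by blast
    then have "mu w \<noteq> None" by (auto simp: happy_def)
    then obtain mu1 where mu1: "partial_ok {..<4} G mu1" "\<forall>u. mu1 u = None \<longleftrightarrow> mu u = None"
      "\<forall>u. mu1 u \<noteq> mu u \<longrightarrow> dist_le G (2 * t) w u" "happy G inp mu1 w"
      "\<forall>z. happy G inp mu z \<longrightarrow> happy G inp mu1 z"
      using repair_node[OF wf inp less.prems w(1) _ card] by blast
    have "?bad mu1 \<subset> ?bad mu" using w mu1(4,5) by blast
    moreover have "finite (?bad mu)" using wf by (simp add: wf_graph_def)
    ultimately have "card (?bad mu1) < card (?bad mu)" by (rule psubset_card_mono[rotated])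
    from less.hyps[OF this mu1(1)] obtain mu' where mu': "partial_ok {..<4} G mu'"
      "\<forall>u. mu' u = None \<longleftrightarrow> mu1 u = None"
      "\<forall>u. mu' u \<noteq> mu1 u \<longrightarrow> (\<exists>w\<in>gV G. \<not> happy G inp mu1 w \<and> dist_le G (2 * t) w u)"
      "\<forall>z\<in>gV G. happy G inp mu' z" by blast
    \<comment> \<open>A repair creates no new violations, so every change stays near a violation of
      \<open>mu\<close> itself and distances do not accumulate.\<close>
    have "\<exists>w\<in>gV G. \<not> happy G inp mu w \<and> dist_le G (2 * t) w u" if "mu' u \<noteq> mu u" for u
    proof (cases "mu' u = mu1 u")
      case True
      then show ?thesis using that mu1(3) w by metis
    next
      case False
      then show ?thesis using mu'(3) mu1(5) by blast
    qed
    then show ?thesis using mu' mu1(2) by blast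
  qed
qed

text \<open>Output 0 at \<open>v\<close> satisfies \<open>v\<close> and can upset only its
  neighbours; repairing these within \<open>2 * t\<close> changes nothing beyond distance
  \<open>1 + 2 * t\<close>.\<close>

lemma pointer_verifier_mendable:
  "verifier_mendable \<Delta> {..<5} {..<4} 1 pointer_ok (\<lambda>n. 2 * sqrt (real n) + 1)"
  unfolding verifier_mendable_def
proof (intro allI impI, elim conjE)
  fix G inp lam v
  assume "bdeg_graph \<Delta> G" and inp: "inputs_ok {..<5} G inp" and ok: "partial_ok {..<4} G lam"
    and acc: "relaxed_accepts {..<4} 1 pointer_ok G inp lam" and v: "v \<in> gV G"
  then have wf: "wf_graph G" by (simp add: bdeg_graph_def)
  let ?n = "card (gV G)" and ?mu = "lam(v := Some 0)"
  \<comment> \<open>Rounding down keeps \<open>t\<close> at most the square root, while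
    \<open>Suc t\<close> exceeds it, as the counting argument requires.\<close>
  define t where "t = nat \<lfloor>sqrt (real ?n)\<rfloor>"
  have t: "real t \<le> sqrt (real ?n)" "sqrt (real ?n) < real (Suc t)"
    unfolding t_def by (simp, linarith)
  have "(sqrt (real ?n))\<^sup>2 < (real (Suc t))\<^sup>2"
    using t(2) by (intro power_strict_mono) auto
  then have "real ?n < (real (Suc t))\<^sup>2" by simp
  then have card: "?n < (Suc t)\<^sup>2" by (metis of_nat_less_iff of_nat_power)
  have hl: "happy G inp lam z" if "z \<in> gV G" for z
    using acc that relaxed_iff_happy[OF wf that ok] unfolding relaxed_accepts_def by blast
  have ok0: "partial_ok {..<4} G ?mu" using ok by (simp add: partial_ok_def)
  have near: "dist_le G 1 v w" if w: "w \<in> gV G" "\<not> happy G inp ?mu w" for w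
  proof -
    have "w \<noteq> v" using w(2) by (auto simp: happy_def pointer_ok_def)
    have "gE G w v"
    proof (rule ccontr)
      assume nE: "\<not> gE G w v"
      have "u \<noteq> v" if "step G inp d w u" for u d using that nE by (auto simp: step_def)
      then have "pointer_ok G inp (\<lambda>u. the (?mu u)) w \<longleftrightarrow> pointer_ok G inp (\<lambda>u. the (lam u)) w"
        using \<open>w \<noteq> v\<close> unfolding pointer_ok_def by (metis fun_upd_other)
      then show False using hl[OF w(1)] w(2) nE \<open>w \<noteq> v\<close> unfolding happy_def
        by (metis fun_upd_other)
    qed
    then have "gE G v w" using wf by (simp add: wf_graph_def)
    then show ?thesis using v by auto
  qed
  obtain mu where mu: "partial_ok {..<4} G mu" "\<forall>u. mu u = None \<longleftrightarrow> ?mu u = None"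
    "\<forall>u. mu u \<noteq> ?mu u \<longrightarrow> (\<exists>w\<in>gV G. \<not> happy G inp ?mu w \<and> dist_le G (2 * t) w u)"
    "\<forall>z\<in>gV G. happy G inp mu z"
    using repair_all[OF wf inp ok0 card] by blast
  have "dist_le G (1 + 2 * t) v u" if "mu u \<noteq> lam u" for u
  proof (cases "mu u = ?mu u")
    case True
    then have "u = v" using that by (metis fun_upd_other)
    then show ?thesis using v dist_le_mono[of G 0 v v] by simp
  next
    case False
    then show ?thesis using mu(3) near dist_le_trans by blast
  qed
  moreover have "real (1 + 2 * t) \<le> 2 * sqrt (real ?n) + 1" using t(1) by simp
  ultimately have "within_real G (2 * sqrt (real ?n) + 1) v u" if "mu u \<noteq> lam u" for u
    using that unfolding within_real_def by blast
  moreover have "relaxed_accepts {..<4} 1 pointer_ok G inp mu"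
    using mu(4) relaxed_iff_happy[OF wf _ mu(1)] unfolding relaxed_accepts_def by blast
  moreover have "mu v \<noteq> None" "\<forall>u. mu u = None \<longrightarrow> lam u = None" using mu(2) by (auto split: if_splits)
  ultimately show "\<exists>mu. is_mend {..<4} 1 pointer_ok G inp lam v (2 * sqrt (real ?n) + 1) mu"
    using mu(1) unfolding is_mend_def by blast
qed

section \<open>The lower bound on square grids\<close>

definition xc :: "nat \<Rightarrow> nat" where "xc a = fst (prod_decode a)"
definition yc :: "nat \<Rightarrow> nat" where "yc a = snd (prod_decode a)"
definition pt :: "nat \<Rightarrow> nat \<Rightarrow> nat" where "pt x y = prod_encode (x, y)"

lemma xc_pt [simp]: "xc (pt x y) = x" and yc_pt [simp]: "yc (pt x y) = y"
  by (simp_all add: xc_def yc_def pt_def)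

lemma pt_coords [simp]: "pt (xc a) (yc a) = a"
  by (simp add: xc_def yc_def pt_def)

lemma node_eqI: "xc a = xc b \<Longrightarrow> yc a = yc b \<Longrightarrow> a = b"
  by (metis pt_coords)

definition adjacent :: "nat \<Rightarrow> nat \<Rightarrow> bool" where
  "adjacent a b \<longleftrightarrow> xc a = xc b \<and> (yc b = Suc (yc a) \<or> yc a = Suc (yc b)) \<or>
     yc a = yc b \<and> (xc b = Suc (xc a) \<or> xc a = Suc (xc b))"

definition grid :: "nat \<Rightarrow> graph" where
  "grid M = ({a. xc a < M \<and> yc a < M},
     \<lambda>a b. xc a < M \<and> yc a < M \<and> xc b < M \<and> yc b < M \<and> adjacent a b)"

text \<open>Right, left, up and down change this value by 1, 4, 2 and 3 modulo 5, so the residue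
  alone identifies a neighbour.\<close>

definition grid_input :: "nat \<Rightarrow> nat" where
  "grid_input a = (xc a + 2 * yc a) mod 5"

lemma gV_grid: "a \<in> gV (grid M) \<longleftrightarrow> xc a < M \<and> yc a < M"
  by (simp add: gV_def grid_def)

lemma gE_grid: "gE (grid M) a b \<longleftrightarrow> a \<in> gV (grid M) \<and> b \<in> gV (grid M) \<and> adjacent a b"
  by (auto simp: gE_def gV_def grid_def)

lemma gV_grid_image: "gV (grid M) = prod_encode ` ({..<M} \<times> {..<M})"
proof
  show "prod_encode ` ({..<M} \<times> {..<M}) \<subseteq> gV (grid M)"
    unfolding pt_def[symmetric] by (auto simp: gV_grid xc_def yc_def)
  show "gV (grid M) \<subseteq> prod_encode ` ({..<M} \<times> {..<M})"
  proof
    fix a assume "a \<in> gV (grid M)"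
    then have "(xc a, yc a) \<in> {..<M} \<times> {..<M}" by (simp add: gV_grid)
    then have "pt (xc a) (yc a) \<in> prod_encode ` ({..<M} \<times> {..<M})" unfolding pt_def by (rule imageI)
    then show "a \<in> prod_encode ` ({..<M} \<times> {..<M})" by simp
  qed
qed

lemma finite_grid: "finite (gV (grid M))"
  by (simp add: gV_grid_image)

lemma card_grid: "card (gV (grid M)) = M\<^sup>2"
  unfolding gV_grid_image card_image[OF inj_prod_encode]
  by (simp add: card_cartesian_product power2_eq_square)

lemma bdeg_grid: "bdeg_graph 4 (grid M)"
  unfolding bdeg_graph_def
proof
  show "wf_graph (grid M)"
    unfolding wf_graph_def using finite_grid by (auto simp: gE_grid adjacent_def)
  show "\<forall>v\<in>gV (grid M). card {u. gE (grid M) v u} \<le> 4"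
  proof
    fix v
    \<comment> \<open>At the border, truncated subtraction merely adds \<open>v\<close> itself to
      this upper bound.\<close>
    let ?S = "{pt (Suc (xc v)) (yc v), pt (xc v - 1) (yc v), pt (xc v) (Suc (yc v)), pt (xc v) (yc v - 1)}"
    have "u \<in> ?S" if "gE (grid M) v u" for u
    proof -
      have u: "u = pt (xc u) (yc u)" by simp
      show ?thesis using that by (subst u) (auto simp: gE_grid adjacent_def simp del: pt_coords)
    qed
    then have "{u. gE (grid M) v u} \<subseteq> ?S" by blast
    then have "card {u. gE (grid M) v u} \<le> card ?S" by (intro card_mono) auto
    also have "\<dots> \<le> 4" by (simp add: card_insert_if)
    finally show "card {u. gE (grid M) v u} \<le> 4" .
  qed
qed

lemma grid_input_ok: "inputs_ok {..<5} (grid M) grid_input"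
  by (simp add: inputs_ok_def grid_input_def)

section \<open>Directions and distances in the grid\<close>

lemma mod_add_cancel_nat:
  fixes k d e n :: nat
  assumes "(k + d) mod n = (k + e) mod n" "d < e + n" "e < d + n"
  shows "d = e"
  using assms
proof (induction d e rule: linorder_wlog)
  case (le d e)
  then have "n dvd e - d" using mod_eq_dvd_iff_nat[of "k + d" "k + e" n] by simp
  then have "e - d = 0" using le nat_dvd_not_less[of "e - d" n] by linarith
  then show ?case using le by simp
next
  case (sym d e)
  then show ?case by simp
qed

lemma residue_coords:
  fixes x y :: nat
  shows "(Suc x + 2 * y) mod 5 = ((x + 2 * y) mod 5 + 1) mod 5"
    and "(x + 2 * Suc y) mod 5 = ((x + 2 * y) mod 5 + 2) mod 5"
    and "0 < y \<Longrightarrow> (x + 2 * (y - 1)) mod 5 = ((x + 2 * y) mod 5 + 3) mod 5"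
proof -
  show "(Suc x + 2 * y) mod 5 = ((x + 2 * y) mod 5 + 1) mod 5"
    and "(x + 2 * Suc y) mod 5 = ((x + 2 * y) mod 5 + 2) mod 5"
    by (simp_all add: mod_simps)
  assume "0 < y"
  then obtain z where "y = Suc z" using gr0_implies_Suc by blast
  then have "x + 2 * y + 3 = x + 2 * (y - 1) + 5" by simp
  then show "(x + 2 * (y - 1)) mod 5 = ((x + 2 * y) mod 5 + 3) mod 5"
    by (simp only: mod_add_left_eq mod_add_self2)
qed

text \<open>A grid edge changes \<open>xc + 2 * yc\<close> by 1, -1, 2 or -2. These have different
  residues modulo 5, so \<open>d\<close> determines the move.\<close>

lemma step_grid:
  assumes "step (grid M) grid_input d a b"
  shows "d = 1 \<Longrightarrow> xc b = Suc (xc a) \<and> yc b = yc a"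
    and "d = 2 \<Longrightarrow> xc b = xc a \<and> yc b = Suc (yc a)"
    and "d = 3 \<Longrightarrow> xc b = xc a \<and> yc a = Suc (yc b)"
proof -
  define k k' where "k = xc a + 2 * yc a" and "k' = xc b + 2 * yc b"
  have "k' mod 5 = (k mod 5 + d) mod 5"
    using assms unfolding step_def grid_input_def k_def k'_def by blast
  then have eq: "k' mod 5 = (k + d) mod 5" by (simp only: mod_add_left_eq)
  have "xc b = xc a \<and> yc b = Suc (yc a) \<and> k' = k + 2 \<or>
      xc b = xc a \<and> yc a = Suc (yc b) \<and> k = k' + 2 \<or>
      yc b = yc a \<and> xc b = Suc (xc a) \<and> k' = k + 1 \<or>
      yc b = yc a \<and> xc a = Suc (xc b) \<and> k = k' + 1"
    using assms unfolding step_def gE_grid adjacent_def k_def k'_def by auto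
  moreover have "d = 2" if "k' = k + 2" "d < 5"
    using mod_add_cancel_nat[of k 2 5 d] eq that by simp
  moreover have "d = 1" if "k' = k + 1" "d < 5"
    using mod_add_cancel_nat[of k 1 5 d] eq that by simp
  \<comment> \<open>For the decreasing moves \<open>k' + 5\<close> is compared with
    \<open>k' + (2 + d)\<close>, which avoids negative numbers.\<close>
  moreover have "d = 3" if "k = k' + 2" "d < 5"
    using mod_add_cancel_nat[of k' 5 5 "2 + d"] eq that by (simp add: add.assoc)
  moreover have "d = 4" if "k = k' + 1" "d < 5"
    using mod_add_cancel_nat[of k' 5 5 "1 + d"] eq that by (simp add: add.assoc)
  ultimately have *: "d < 5 \<Longrightarrow> xc b = xc a \<and> yc b = Suc (yc a) \<and> d = 2 \<or>
      xc b = xc a \<and> yc a = Suc (yc b) \<and> d = 3 \<or>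
      yc b = yc a \<and> xc b = Suc (xc a) \<and> d = 1 \<or> d = 4"
    by blast
  show "d = 1 \<Longrightarrow> xc b = Suc (xc a) \<and> yc b = yc a"
    and "d = 2 \<Longrightarrow> xc b = xc a \<and> yc b = Suc (yc a)"
    and "d = 3 \<Longrightarrow> xc b = xc a \<and> yc a = Suc (yc b)"
    using * by simp_all
qed

lemma good_grid:
  assumes "0 < xc a" "Suc (xc a) < M" "0 < yc a" "Suc (yc a) < M"
  shows "good (grid M) grid_input a"
proof -
  let ?s = "step (grid M) grid_input"
  have "grid_input (pt (Suc (xc a)) (yc a)) = (grid_input a + 1) mod 5"
    and "grid_input (pt (xc a) (Suc (yc a))) = (grid_input a + 2) mod 5"
    unfolding grid_input_def xc_pt yc_pt by (rule residue_coords)+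
  moreover have "grid_input (pt (xc a) (yc a - 1)) = (grid_input a + 3) mod 5"
    unfolding grid_input_def xc_pt yc_pt by (rule residue_coords(3)[OF assms(3)])
  ultimately have ex: "?s 1 a (pt (Suc (xc a)) (yc a))" "?s 2 a (pt (xc a) (Suc (yc a)))"
    "?s 3 a (pt (xc a) (yc a - 1))"
    using assms by (simp_all add: step_def gE_grid gV_grid adjacent_def)
  show ?thesis
    unfolding good_def
  proof
    fix d :: nat assume d: "d \<in> {1,2,3}"
    then obtain b where b: "?s d a b" using ex by blast
    have "b' = b" if b': "?s d a b'" for b'
    proof -
      consider "d = 1" | "d = 2" | "d = 3" using d by blast
      then have "xc b' = xc b \<and> yc b' = yc b"
      proof cases
        case 1 then show ?thesis using step_grid(1)[OF b] step_grid(1)[OF b'] by simp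
      next
        case 2 then show ?thesis using step_grid(2)[OF b] step_grid(2)[OF b'] by simp
      next
        case 3 then show ?thesis using step_grid(3)[OF b] step_grid(3)[OF b'] by simp
      qed
      then show ?thesis using node_eqI by blast
    qed
    with b show "\<exists>!b. ?s d a b" by blast
  qed
qed

definition dist1 :: "nat \<Rightarrow> nat \<Rightarrow> int" where
  "dist1 a b = \<bar>int (xc a) - int (xc b)\<bar> + \<bar>int (yc a) - int (yc b)\<bar>"

text \<open>One step changes the L1 distance by at most 1, and every node other than
  \<open>a\<close> has a grid neighbour closer to \<open>a\<close>.\<close>

lemma dist_le_grid:
  "dist_le (grid M) k a b \<longleftrightarrow> a \<in> gV (grid M) \<and> b \<in> gV (grid M) \<and> dist1 a b \<le> int k"
proof (induction k arbitrary: b)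
  case 0
  then show ?case by (auto simp: dist1_def intro: node_eqI)
next
  case (Suc k)
  show ?case (is "?L \<longleftrightarrow> ?R")
  proof
    assume ?L
    then show ?R by (auto simp: Suc.IH gE_grid adjacent_def dist1_def)
  next
    assume R: ?R
    show ?L
    proof (cases "a = b")
      case True
      then show ?thesis using R Suc.IH[of b] by (simp add: dist1_def)
    next
      case False
      have "\<exists>c\<in>gV (grid M). adjacent c b \<and> dist1 a c < dist1 a b"
      proof (cases "xc a = xc b")
        case True
        then have "yc a \<noteq> yc b" using False node_eqI by blast
        then show ?thesis using R True
          by (intro bexI[of _ "pt (xc b) (if yc a < yc b then yc b - 1 else Suc (yc b))"])
            (auto simp: adjacent_def dist1_def gV_grid)
      next
        case False
        then show ?thesis using R
          by (intro bexI[of _ "pt (if xc a < xc b then xc b - 1 else Suc (xc b)) (yc b)"])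
            (auto simp: adjacent_def dist1_def gV_grid)
      qed
      then obtain c where c: "c \<in> gV (grid M)" "adjacent c b" "dist1 a c < dist1 a b" by blast
      then have "dist_le (grid M) k a c" "gE (grid M) c b" using R by (auto simp: Suc.IH gE_grid)
      then show ?thesis by auto
    qed
  qed
qed

section \<open>Broken pointer chains under arbitrary verifiers\<close>

lemma verifier_cong:
  assumes rv: "radius_verifier \<Delta> \<Sigma> \<Gamma> r \<psi>" and G: "bdeg_graph \<Delta> G" "inputs_ok \<Sigma> G inp"
    and out: "outputs_ok \<Gamma> G lam" "outputs_ok \<Gamma> G lam'"
    and v: "v \<in> gV G" and eq: "\<And>u. u \<in> ball_nodes G r v \<Longrightarrow> lam u = lam' u"
  shows "\<psi> G inp lam v = \<psi> G inp lam' v"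
proof -
  have "nbhd_iso r G inp lam v G inp lam' v"
    unfolding nbhd_iso_def by (rule exI[of _ id]) (use eq in auto)
  then show ?thesis using rv G out v unfolding radius_verifier_def by blast
qed

text \<open>If all these nodes were good, a pointer of maximal abscissa could not point right, and from then
  on the pointers would lead straight up or straight down forever.\<close>

lemma pointer_at_border:
  assumes sol: "is_solution pointer_ok (grid M) grid_input lam"
    and out: "outputs_ok {..<4} (grid M) lam"
    and p: "p \<in> gV (grid M)" "0 < xc p" "lam p \<noteq> 0"
  shows "\<exists>u\<in>gV (grid M). 0 < xc u \<and> lam u \<noteq> 0 \<and> \<not> good (grid M) grid_input u"
proof (rule ccontr)
  assume contr: "\<not> ?thesis"
  let ?Q = "{u \<in> gV (grid M). 0 < xc u \<and> lam u \<noteq> 0}"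
  have finQ: "finite ?Q" using finite_grid by simp
  define m where "m = Max (xc ` ?Q)"
  have "m \<in> xc ` ?Q" unfolding m_def using finQ p by (intro Max_in) auto
  then obtain q where q: "q \<in> ?Q" "xc q = m" by blast
  have le_m: "xc u \<le> m" if "u \<in> ?Q" for u unfolding m_def using finQ that by (intro Max_ge) auto
  have nxt: "\<exists>w. step (grid M) grid_input (lam u) u w \<and> w \<in> gV (grid M) \<and> lam w \<noteq> 0 \<and>
      lam w < 4 \<and> lam u + lam w \<noteq> 5" if u: "u \<in> ?Q" for u
  proof -
    have "pointer_ok (grid M) grid_input lam u" "good (grid M) grid_input u"
      using sol contr u by (auto simp: is_solution_def)
    then obtain w where w: "step (grid M) grid_input (lam u) u w" "lam w \<noteq> 0" "lam u + lam w \<noteq> 5"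
      using u unfolding pointer_ok_def by blast
    then have "w \<in> gV (grid M)" by (simp add: step_def gE_grid)
    then show ?thesis using w out by (auto simp: outputs_ok_def)
  qed
  have not1: "lam u \<noteq> 1" if u: "u \<in> ?Q" "xc u = m" for u
  proof
    assume 1: "lam u = 1"
    obtain w where w: "step (grid M) grid_input 1 u w" "w \<in> gV (grid M)" "lam w \<noteq> 0"
      using nxt[OF u(1)] 1 by auto
    then have "xc w = Suc m" using step_grid(1) u by blast
    then show False using le_m[of w] w by simp
  qed
  \<comment> \<open>The highest node of abscissa \<open>m\<close> that points up leads to a higher
    one, which may neither turn back with 3 nor go right, and hence points up as well.\<close>
  have not2: "lam u \<noteq> 2" if u: "u \<in> ?Q" "xc u = m" for u
  proof
    assume "lam u = 2"
    let ?U = "{u \<in> ?Q. xc u = m \<and> lam u = 2}"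
    have fin: "finite (yc ` ?U)" by (rule finite_imageI, rule finite_subset[OF _ finQ]) auto
    have "Max (yc ` ?U) \<in> yc ` ?U" using fin u \<open>lam u = 2\<close> by (intro Max_in) auto
    then obtain h where h: "h \<in> ?U" "Max (yc ` ?U) = yc h" by blast
    obtain w where w: "step (grid M) grid_input 2 h w" "w \<in> gV (grid M)" "lam w \<noteq> 0" "lam w < 4" "lam w \<noteq> 3"
      using nxt[of h] h by auto
    have c: "xc w = m" "yc w = Suc (yc h)" using step_grid(2)[OF w(1)] h by auto
    have wQ: "w \<in> ?Q" using w c h by auto
    have "lam w = 2" using not1[OF wQ c(1)] w by linarith
    then have "w \<in> ?U" using wQ c by simp
    then have "yc w \<le> Max (yc ` ?U)" by (intro Max_ge fin imageI)
    then show False using c(2) h(2) by linarith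
  qed
  have "lam q < 4" using q out by (auto simp: outputs_ok_def)
  then have "lam q = 3" using not1[OF q] not2[OF q] q by auto
  \<comment> \<open>On abscissa \<open>m\<close> only output 3 remains, so the lowest such node
    leads to a still lower one.\<close>
  let ?U = "{u \<in> ?Q. xc u = m}"
  have fin: "finite (yc ` ?U)" by (rule finite_imageI, rule finite_subset[OF _ finQ]) auto
  have "Min (yc ` ?U) \<in> yc ` ?U" using fin q by (intro Min_in) auto
  then obtain h where h: "h \<in> ?U" "Min (yc ` ?U) = yc h" by blast
  have "lam h < 4" using h out by (auto simp: outputs_ok_def)
  then have "lam h = 3" using not1[of h] not2[of h] h by auto
  then obtain w where w: "step (grid M) grid_input 3 h w" "w \<in> gV (grid M)" "lam w \<noteq> 0"
    using nxt[of h] h by auto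
  have c: "xc w = m" "yc h = Suc (yc w)" using step_grid(3)[OF w(1)] h by auto
  have "w \<in> ?U" using w c h by auto
  then have "Min (yc ` ?U) \<le> yc w" by (intro Min_le fin imageI)
  then show False using c(2) h(2) by linarith
qed

text \<open>In the middle row pointers run right from the left border to an unlabelled centre; all
  other outputs are 0. Each ball missing the centre agrees with one of two genuine solutions, so
  every correct verifier, of any radius, accepts. A mend close to the centre keeps the start of the
  chain and changes only interior nodes, although the chain needs a nonzero output at a node that is
  not good.\<close>

lemma pointer_not_mendable:
  assumes small: "T \<in> o(\<lambda>n. sqrt (real n))"
  shows "\<not> problem_mendable 4 {..<5} {..<4} pointer_ok T"
proof
  assume "problem_mendable 4 {..<5} {..<4} pointer_ok T"
  then obtain r \<psi> where rv: "radius_verifier 4 {..<5} {..<4} r \<psi>"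
    and equiv: "\<And>G inp lam. bdeg_graph 4 G \<Longrightarrow> inputs_ok {..<5} G inp \<Longrightarrow> outputs_ok {..<4} G lam \<Longrightarrow>
      is_solution \<psi> G inp lam \<longleftrightarrow> is_solution pointer_ok G inp lam"
    and mend: "verifier_mendable 4 {..<5} {..<4} r \<psi> T"
    unfolding problem_mendable_def by blast
  have "eventually (\<lambda>n. norm (T n) \<le> 1/4 * norm (sqrt (real n))) at_top"
    using landau_o.smallD[OF small, of "1/4"] by simp
  then obtain N where N: "\<And>n. n \<ge> N \<Longrightarrow> \<bar>T n\<bar> \<le> 1/4 * sqrt (real n)"
    by (auto simp: eventually_at_top_linorder)
  \<comment> \<open>An odd side gives a centre \<open>(c, c)\<close>. The summand \<open>N\<close>
    puts \<open>M\<^sup>2\<close> beyond the threshold, and 4 makes \<open>M / 4\<close> smaller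
    than \<open>c - 1\<close>.\<close>
  define c where "c = N + 4"
  define M where "M = 2 * c + 1"
  have "N \<le> M" unfolding M_def c_def by simp
  also have "M \<le> M\<^sup>2" by (simp add: power2_eq_square)
  finally have "T (M\<^sup>2) \<le> 1/4 * sqrt (real (M\<^sup>2))" using N[of "M\<^sup>2"] by simp
  also have "\<dots> = real M / 4" by simp
  also have "\<dots> < real c - 1" unfolding M_def c_def by simp
  finally have T: "T (M\<^sup>2) < real c - 1" .
  let ?G = "grid M" and ?v = "pt c c"
  have v: "?v \<in> gV ?G" by (simp add: gV_grid M_def)
  define lam where "lam u = (if u = ?v then None else if yc u = c \<and> xc u < c then Some 1 else Some (0::nat))" for u
  define full where "full u = (if yc u = c then 1 else 0 :: nat)" for u
  have out: "outputs_ok {..<4} ?G full" "outputs_ok {..<4} ?G (\<lambda>_. 0)"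
    by (auto simp: outputs_ok_def full_def)
  have "is_solution pointer_ok ?G grid_input full"
    unfolding is_solution_def pointer_ok_def
  proof (intro ballI impI, elim conjE)
    fix u assume "good ?G grid_input u" "full u \<noteq> 0"
    then have u: "full u = 1" "yc u = c" by (auto simp: full_def split: if_splits)
    obtain w where w: "step ?G grid_input 1 u w" using \<open>good ?G grid_input u\<close> unfolding good_def by blast
    then have "full w = 1" using step_grid(1)[OF w] u by (simp add: full_def)
    then show "\<exists>w. step ?G grid_input (full u) u w \<and> full w \<noteq> 0 \<and> full u + full w \<noteq> 5"
      using u w by auto
  qed
  then have full: "is_solution \<psi> ?G grid_input full"
    using equiv[OF bdeg_grid grid_input_ok out(1)] by simp
  have zero: "is_solution \<psi> ?G grid_input (\<lambda>_. 0)"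
    using equiv[OF bdeg_grid grid_input_ok out(2)] by (simp add: is_solution_def pointer_ok_def)
  have acc: "relaxed_accepts {..<4} r \<psi> ?G grid_input lam"
    unfolding relaxed_accepts_def
  proof
    fix w assume w: "w \<in> gV ?G"
    show "relaxed {..<4} r \<psi> ?G grid_input lam w"
    proof (cases "?v \<in> ball_nodes ?G r w")
      case True
      then show ?thesis unfolding relaxed_def lam_def by auto
    next
      case nb: False
      then have far: "dist1 w ?v > int r" using v w by (simp add: ball_nodes_def dist_le_grid)
      have "\<exists>sol. outputs_ok {..<4} ?G sol \<and> is_solution \<psi> ?G grid_input sol \<and>
          (\<forall>u\<in>ball_nodes ?G r w. lam u = Some (sol u))"
      \<comment> \<open>Nodes of the middle row on the far side of the centre are at least as far
        from \<open>w\<close> as the centre, so the ball misses them: it looks like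
        \<open>full\<close> on the left and like the zero solution on the right.\<close>
      proof (cases "xc w \<le> c")
        case True
        have "lam u = Some (full u)" if "u \<in> ball_nodes ?G r w" for u
        proof -
          have "u \<noteq> ?v" using that nb by blast
          then show ?thesis
            using that far True by (auto simp: ball_nodes_def dist_le_grid dist1_def lam_def full_def)
        qed
        then show ?thesis using out full by blast
      next
        case False
        have "lam u = Some 0" if "u \<in> ball_nodes ?G r w" for u
        proof -
          have "u \<noteq> ?v" using that nb by blast
          then show ?thesis
            using that far False by (auto simp: ball_nodes_def dist_le_grid dist1_def lam_def)
        qed
        then show ?thesis using out zero by blast
      qed
      then obtain sol where sol: "outputs_ok {..<4} ?G sol" "\<psi> ?G grid_input sol w"
          "\<forall>u\<in>ball_nodes ?G r w. lam u = Some (sol u)"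
        using w by (auto simp: is_solution_def)
      have "\<psi> ?G grid_input lam' w"
        if "outputs_ok {..<4} ?G lam'" "\<forall>u\<in>ball_nodes ?G r w. lam u = Some (lam' u)" for lam'
      proof -
        have "lam' u = sol u" if "u \<in> ball_nodes ?G r w" for u
          using sol(3) \<open>\<forall>u\<in>ball_nodes ?G r w. lam u = Some (lam' u)\<close> that by force
        then show ?thesis
          using verifier_cong[OF rv bdeg_grid grid_input_ok that(1) sol(1) w] sol(2) by blast
      qed
      then show ?thesis unfolding relaxed_def by blast
    qed
  qed
  have "partial_ok {..<4} ?G lam" by (auto simp: partial_ok_def lam_def)
  then obtain mu where "is_mend {..<4} r \<psi> ?G grid_input lam ?v (T (M\<^sup>2)) mu"
    using mend bdeg_grid grid_input_ok acc v unfolding verifier_mendable_def card_grid[symmetric] by blast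
  then have ok: "partial_ok {..<4} ?G mu" and accm: "relaxed_accepts {..<4} r \<psi> ?G grid_input mu"
    and "mu ?v \<noteq> None" "\<forall>u\<in>gV ?G. mu u = None \<longrightarrow> lam u = None"
    and chg: "\<forall>u\<in>gV ?G. mu u \<noteq> lam u \<longrightarrow> within_real ?G (T (M\<^sup>2)) ?v u"
    unfolding is_mend_def by auto
  \<comment> \<open>\<open>lam\<close> is undefined only at the centre, so the mend is total and
    thus a solution of the original problem.\<close>
  then have some: "mu u \<noteq> None" if "u \<in> gV ?G" for u
    using that unfolding lam_def by (metis option.distinct(1))
  let ?mu = "\<lambda>u. the (mu u)"
  have outm: "outputs_ok {..<4} ?G ?mu" using ok some by (auto simp: partial_ok_def outputs_ok_def)
  have "is_solution \<psi> ?G grid_input ?mu"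
    unfolding is_solution_def
  proof
    fix w assume "w \<in> gV ?G"
    then have "relaxed {..<4} r \<psi> ?G grid_input mu w" using accm by (simp add: relaxed_accepts_def)
    moreover have "\<forall>u\<in>ball_nodes ?G r w. mu u = Some (?mu u)" using some by (auto simp: ball_nodes_def)
    ultimately show "\<psi> ?G grid_input ?mu w" unfolding relaxed_def using outm by fastforce
  qed
  then have sol: "is_solution pointer_ok ?G grid_input ?mu"
    using equiv[OF bdeg_grid grid_input_ok outm] by simp
  have close: "dist1 ?v u < int c - 1" if u: "u \<in> gV ?G" "mu u \<noteq> lam u" for u
  proof -
    obtain k where "real k \<le> T (M\<^sup>2)" "dist_le ?G k ?v u" using chg u unfolding within_real_def by blast
    then have "real k < real c - 1" "dist1 ?v u \<le> int k" using T by (auto simp: dist_le_grid)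
    then show ?thesis by linarith
  qed
  \<comment> \<open>At distance exactly \<open>c - 1\<close> from the centre, this node is just out
    of reach of the mend; its abscissa is positive, as \<open>pointer_at_border\<close>
    asks.\<close>
  let ?p = "pt 1 c"
  have "mu ?p = lam ?p"
    using close[of ?p] by (auto simp: gV_grid M_def dist1_def c_def)
  moreover have "lam ?p = Some 1"
    unfolding lam_def c_def by (auto dest: arg_cong[of _ _ xc])
  ultimately have "\<exists>u\<in>gV ?G. 0 < xc u \<and> ?mu u \<noteq> 0 \<and> \<not> good ?G grid_input u"
    by (intro pointer_at_border[OF sol outm, of ?p]) (auto simp: gV_grid M_def c_def)
  then obtain u where u: "u \<in> gV ?G" "0 < xc u" "?mu u \<noteq> 0" "\<not> good ?G grid_input u" by blast
  \<comment> \<open>A nonzero output lies on the unchanged chain or in the changed region; at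
    positive abscissa both consist of interior nodes.\<close>
  have "good ?G grid_input u"
  proof (cases "mu u = lam u")
    case True
    then have "yc u = c" "xc u < c"
      using u(3) some[OF u(1)] by (auto simp: lam_def split: if_splits)
    then show ?thesis using u(2) by (intro good_grid) (auto simp: M_def c_def)
  next
    case False
    then have "dist1 ?v u < int c - 1" using close u(1) by blast
    then show ?thesis by (intro good_grid) (auto simp: M_def dist1_def)
  qed
  then show False using u(4) by blast
qed

theorem theorem8p7:
  shows "\<exists>\<Delta> \<Sigma> \<Gamma> r \<psi>. is_LCL \<Delta> \<Sigma> \<Gamma> r \<psi> \<and>
     (\<exists>T. T \<in> O(\<lambda>n. sqrt (real n)) \<and> problem_mendable \<Delta> \<Sigma> \<Gamma> \<psi> T) \<and>
     (\<forall>T'. T' \<in> o(\<lambda>n. sqrt (real n)) \<longrightarrow> \<not> problem_mendable \<Delta> \<Sigma> \<Gamma> \<psi> T')"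
proof -
  \<comment> \<open>The upper bound holds for every degree bound; 4 is the one that admits the
    grids.\<close>
  let ?T = "\<lambda>n. 2 * sqrt (real n) + 1"
  have lcl: "is_LCL 4 {..<5} {..<4} 1 pointer_ok" by (rule pointer_LCL)
  have "?T \<in> O(\<lambda>n. sqrt (real n))"
  proof (rule bigoI[of _ 3])
    show "eventually (\<lambda>n. norm (?T n) \<le> 3 * norm (sqrt (real n))) at_top"
      using eventually_ge_at_top[of 1] by eventually_elim simp
  qed
  moreover have "problem_mendable 4 {..<5} {..<4} pointer_ok ?T"
    unfolding problem_mendable_def using lcl pointer_verifier_mendable unfolding is_LCL_def by blast
  ultimately show ?thesis using lcl pointer_not_mendable by blast
qed

end
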